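(* Let $X$ be a Banach space over $\mathbb{K}\in\{\mathbb{R},\mathbb{C}\}$, let $\Lambda$ be a nonempty set, let $X_\lambda$, $\lambda\in\Lambda$, be closed linear subspaces of $X$, and let $Y$ be a finite dimensional subspace of $X$. Suppose that $\mathcal{L}(X_\lambda\mid\lambda\in\Lambda)$ is dense in $X$. If there exists $\varepsilon>0$ such that $$\sup_{\lambda\in\Lambda}\|\varphi\upharpoonright_{X_\lambda}\|\geqslant\varepsilon\|\varphi\|\quad\text{for every }\varphi\in Y^{\bot},$$ then the family $(X_\lambda)_{\lambda\in\Lambda}$ is an absolutely representing family of subspaces (ARFS) in $X$.
   Context: A family $(X_\lambda)_{\lambda\in\Lambda}$ of closed linear subspaces of $X$ is called an absolutely representing family of subspaces (ARFS) in $X$ if for every $x\in X$ there exist $x_\lambda\in X_\lambda$, $\lambda\in\Lambda$, such that $\sum_{\lambda\in\Lambda}\|x_\lambda\|<\infty$ and $x=\sum_{\lambda\in\Lambda}x_\lambda$. $\mathcal{L}(X_\lambda\mid\lambda\in\Lambda)$ is the (algebraic) linear span of $\bigcup_{\lambda\in\Lambda}X_\lambda$. $Y^{\bot}=\{\varphi\in X^*\mid\varphi\upharpoonright_Y=0\}$, and $\|\varphi\upharpoonright_{X_\lambda}\|$ is the norm of the restriction of $\varphi$ to $X_\lambda$ as an element of $X_\lambda^*$ (equal to $0$ if $X_\lambda=\{0\}$). *)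

theory Defs
  imports "HOL-Analysis.Analysis"
begin

text \<open>
  The scalar field is a type of the following class: a real normed field that is
  isometrically isomorphic either to the real numbers or to the complex numbers.
\<close>

class real_or_complex = real_normed_field +
  assumes real_or_complex:
    "\<exists>f :: 'a \<Rightarrow> complex.
       (\<forall>x y. f (x + y) = f x + f y) \<and> (\<forall>x y. f (x * y) = f x * f y) \<and>
       (\<forall>x. cmod (f x) = norm x) \<and> (range f = \<real> \<or> range f = UNIV)"

instance real :: real_or_complex
  by standard (rule exI[of _ complex_of_real], auto simp: Reals_def)

instance complex :: real_or_complex
  by standard (rule exI[of _ "\<lambda>z. z"], auto)

text \<open>
  A normed space over the scalar field. The topology, the norm and the underlying real
  vector space are those of the type class of \<open>'a\<close>; it is a Banach space over the scalar
  field when \<open>'a\<close> is of class \<^class>\<open>banach\<close>.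
\<close>

locale normed_space_over = vector_space scale
  for scale :: "'k::real_or_complex \<Rightarrow> 'a::real_normed_vector \<Rightarrow> 'a" +
  assumes norm_scale: "norm (scale c x) = norm c * norm x"
    and scale_of_real: "scale (of_real r) x = r *\<^sub>R x"

lemma normed_space_over_real: "normed_space_over ((*\<^sub>R) :: real \<Rightarrow> 'a::real_normed_vector \<Rightarrow> 'a)"
  by unfold_locales (auto simp: algebra_simps)

lemma normed_space_over_self: "normed_space_over ((*) :: 'k::real_or_complex \<Rightarrow> 'k \<Rightarrow> 'k)"
  by unfold_locales (auto simp: algebra_simps norm_mult scaleR_conv_of_real)

text \<open>
  The norm of the restriction of \<open>\<phi>\<close> to a subspace \<open>S\<close>, in the same form as \<^const>\<open>onorm\<close>.
  As \<open>0 / 0 = 0\<close>, the point \<open>0\<close> contributes \<open>0\<close>; in particular the value is \<open>0\<close> for \<open>S = {0}\<close>.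
\<close>

definition onorm_on :: "'a::real_normed_vector set \<Rightarrow> ('a \<Rightarrow> 'b::real_normed_vector) \<Rightarrow> real" where
  "onorm_on S \<phi> = (SUP x\<in>S. norm (\<phi> x) / norm x)"

lemma onorm_on_UNIV: "onorm_on UNIV \<phi> = onorm \<phi>"
  by (simp add: onorm_on_def onorm_def)

context normed_space_over
begin

definition dual :: "('a \<Rightarrow> 'k) set" where
  "dual = {\<phi>. Vector_Spaces.linear scale (*) \<phi> \<and> bounded_linear \<phi>}"

definition annihilator :: "'a set \<Rightarrow> ('a \<Rightarrow> 'k) set" where
  "annihilator Y = {\<phi> \<in> dual. \<forall>y\<in>Y. \<phi> y = 0}"

definition fin_dim_subspace :: "'a set \<Rightarrow> bool" where
  "fin_dim_subspace Y \<longleftrightarrow> subspace Y \<and> (\<exists>B. finite B \<and> span B = Y)"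

definition ARFS :: "'i set \<Rightarrow> ('i \<Rightarrow> 'a set) \<Rightarrow> bool" where
  "ARFS \<Lambda> X \<longleftrightarrow>
     (\<forall>l\<in>\<Lambda>. subspace (X l) \<and> closed (X l)) \<and>
     (\<forall>x. \<exists>u. (\<forall>l\<in>\<Lambda>. u l \<in> X l) \<and> (\<lambda>l. norm (u l)) summable_on \<Lambda> \<and> (u has_sum x) \<Lambda>)"

end

end

theory Submission
  imports Defs
begin

text \<open>
  Fix \<open>K > 0\<close> and let \<open>p x\<close> be the infimum of \<open>c + K * norm (x - v - y)\<close> over \<open>y \<in> Y\<close> and all sums \<open>v\<close> of
  vectors from the \<open>X l\<close> with total norm at most \<open>c\<close>. By the Hahn--Banach theorem the seminorm \<open>p\<close> is
  attained at any given point \<open>x\<close> by a functional \<open>\<phi>\<close> with \<open>norm \<circ> \<phi> \<le> p\<close>. It vanishes on \<open>Y\<close> and has norm at most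
  1 on every \<open>X l\<close>, so the hypothesis gives \<open>p x \<le> norm x / \<epsilon>\<close>, whatever \<open>K\<close> is. For \<open>K\<close> large, \<open>x\<close> is thus
  approximated modulo \<open>Y\<close>, with small relative error, by sums \<open>v\<close> of cost \<open>O(norm x)\<close>.

  The generators of \<open>Y\<close> can be discarded one at a time. If \<open>b\<close> lies in the closure of the span \<open>Z\<close> of
  the others, replace it by an element of \<open>Z\<close>. Otherwise its coefficient in an element of
  \<open>span (insert b Z)\<close> is controlled by the norm, and by density \<open>b\<close> can be replaced by a
  nearby sum of finite cost. Once \<open>Y\<close> is gone, iterate on the residual, as in the open mapping theorem.
\<close>

subsection \<open>The Hahn--Banach theorem\<close>

definition sublinear :: "('a::real_vector \<Rightarrow> real) \<Rightarrow> bool" where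
  "sublinear q \<longleftrightarrow> (\<forall>x y. q (x + y) \<le> q x + q y) \<and> (\<forall>r x. r \<ge> 0 \<longrightarrow> q (r *\<^sub>R x) = r * q x)"

lemma sublinear_add: "sublinear q \<Longrightarrow> q (x + y) \<le> q x + q y"
  and sublinear_scaleR: "sublinear q \<Longrightarrow> r \<ge> 0 \<Longrightarrow> q (r *\<^sub>R x) = r * q x"
  by (simp_all add: sublinear_def)

lemma sublinear_0: "sublinear q \<Longrightarrow> q 0 = 0"
  using sublinear_scaleR[of q 0 0] by simp

text \<open>A majorant of \<open>q\<close> at \<open>- x\<close> thereby bounds \<open>q x\<close>
  from below, which keeps infima over chains of functionals finite.\<close>

lemma sublinear_minus: "sublinear q \<Longrightarrow> - q (- x) \<le> q x"
  using sublinear_add[of q x "- x"] sublinear_0[of q] by simp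

text \<open>The inequality for \<open>r > 0\<close> is enough: applied with \<open>inverse r\<close>
  at the scaled point, it yields the reverse one.\<close>

lemma sublinearI:
  assumes add: "\<And>x y. q (x + y) \<le> q x + q y"
    and zero: "q 0 = 0"
    and scaleR: "\<And>r x. r > 0 \<Longrightarrow> q (r *\<^sub>R x) \<le> r * q x"
  shows "sublinear q"
proof -
  have "q (r *\<^sub>R x) = r * q x" if "r \<ge> 0" for r x
  proof (cases "r = 0")
    case False
    with that have r: "r > 0" by simp
    have "q x = q (inverse r *\<^sub>R r *\<^sub>R x)" using r by simp
    also have "\<dots> \<le> inverse r * q (r *\<^sub>R x)" using r by (intro scaleR) simp
    finally have "r * q x \<le> q (r *\<^sub>R x)" using r by (simp add: field_simps)
    with scaleR[OF r, of x] show ?thesis by simp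
  qed (simp add: zero)
  with add show ?thesis by (simp add: sublinear_def)
qed

text \<open>
  The largest sublinear functional below \<open>q\<close> with value \<open>- q y\<close> at \<open>- y\<close>; a minimal sublinear
  functional agrees with all its tilts and is therefore linear.
\<close>

definition tilt :: "('a::real_vector \<Rightarrow> real) \<Rightarrow> 'a \<Rightarrow> 'a \<Rightarrow> real" where
  "tilt q y x = (INF t\<in>{0..}. q (x + t *\<^sub>R y) - t * q y)"

lemma tilt_le:
  assumes "sublinear q" "t \<ge> 0"
  shows "tilt q y x \<le> q (x + t *\<^sub>R y) - t * q y"
  unfolding tilt_def
proof (rule cINF_lower)
  have "- q (- x) \<le> q (x + s *\<^sub>R y) - s * q y" if "s \<ge> 0" for s
    using sublinear_add[OF assms(1), of "x + s *\<^sub>R y" "- x"] sublinear_scaleR[OF assms(1) that, of y]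
    by simp
  then show "bdd_below ((\<lambda>t. q (x + t *\<^sub>R y) - t * q y) ` {0..})"
    by (intro bdd_belowI2[of _ "- q (- x)"]) simp
qed (use assms in simp)

lemma le_tilt:
  assumes "\<And>t. t \<ge> 0 \<Longrightarrow> m \<le> q (x + t *\<^sub>R y) - t * q y"
  shows "m \<le> tilt q y x"
  unfolding tilt_def by (rule cINF_greatest) (use assms in auto)

lemma tilt_le_self: "sublinear q \<Longrightarrow> tilt q y x \<le> q x"
  using tilt_le[of q 0 y x] by simp

text \<open>Competitors at \<open>s\<close> and \<open>t\<close> combine to one at
  \<open>s + t\<close>, and scaling by \<open>r\<close> turns the competitor at \<open>t\<close>
  into the one at \<open>r * t\<close>.\<close>

lemma sublinear_tilt:
  assumes q: "sublinear q"
  shows "sublinear (tilt q y)"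
proof (rule sublinearI)
  fix x x'
  have *: "tilt q y (x + x') \<le> (q (x + s *\<^sub>R y) - s * q y) + (q (x' + t *\<^sub>R y) - t * q y)"
    if "s \<ge> 0" "t \<ge> 0" for s t
    using tilt_le[OF q, of "s + t" y "x + x'"] sublinear_add[OF q, of "x + s *\<^sub>R y" "x' + t *\<^sub>R y"] that
    by (simp add: algebra_simps)
  have "tilt q y (x + x') - (q (x + s *\<^sub>R y) - s * q y) \<le> tilt q y x'" if "s \<ge> 0" for s
  proof (rule le_tilt)
    show "tilt q y (x + x') - (q (x + s *\<^sub>R y) - s * q y) \<le> q (x' + t *\<^sub>R y) - t * q y"
      if "t \<ge> 0" for t
      using *[OF \<open>s \<ge> 0\<close> that] by simp
  qed
  then have **: "tilt q y (x + x') - tilt q y x' \<le> q (x + s *\<^sub>R y) - s * q y" if "s \<ge> 0" for s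
    using that by (simp add: algebra_simps)
  have "tilt q y (x + x') - tilt q y x' \<le> tilt q y x"
    by (rule le_tilt) (rule **)
  then show "tilt q y (x + x') \<le> tilt q y x + tilt q y x'" by simp
next
  have "0 \<le> tilt q y 0"
    by (rule le_tilt) (simp add: sublinear_scaleR[OF q])
  then show "tilt q y 0 = 0"
    using tilt_le_self[OF q, of y 0] sublinear_0[OF q] by simp
next
  fix r :: real and x assume r: "r > 0"
  have "inverse r * tilt q y (r *\<^sub>R x) \<le> tilt q y x"
  proof (rule le_tilt)
    fix t :: real assume t: "t \<ge> 0"
    have "tilt q y (r *\<^sub>R x) \<le> q (r *\<^sub>R (x + t *\<^sub>R y)) - (r * t) * q y"
      using tilt_le[OF q, of "r * t" y "r *\<^sub>R x"] r t by (simp add: algebra_simps)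
    also have "\<dots> = r * (q (x + t *\<^sub>R y) - t * q y)"
      using sublinear_scaleR[OF q, of r "x + t *\<^sub>R y"] r by (simp add: algebra_simps)
    finally show "inverse r * tilt q y (r *\<^sub>R x) \<le> q (x + t *\<^sub>R y) - t * q y"
      using r by (simp add: field_simps)
  qed
  then show "tilt q y (r *\<^sub>R x) \<le> r * tilt q y x"
    using r by (simp add: field_simps)
qed

text \<open>Each tilt lies below \<open>q\<close> and so equals it; the competitor
  \<open>t = 1\<close> then says that \<open>q\<close> is superadditive as well.\<close>

lemma minimal_sublinear_linear:
  assumes q: "sublinear q"
    and min: "\<And>q'. sublinear q' \<Longrightarrow> q' \<le> q \<Longrightarrow> q' = q"
  shows "linear q"
proof -
  have tilt_eq: "tilt q y = q" for y
    by (rule min) (auto simp: sublinear_tilt[OF q] le_fun_def tilt_le_self[OF q])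
  have add: "q (x + y) = q x + q y" for x y
    using tilt_le[OF q, of 1 y x] sublinear_add[OF q, of x y] by (simp add: tilt_eq)
  have neg: "q (- x) = - q x" for x
    using add[of x "- x"] sublinear_0[OF q] by simp
  have "q (r *\<^sub>R x) = r * q x" for r x
    using sublinear_scaleR[OF q, of r x] sublinear_scaleR[OF q, of "- r" x] neg[of "r *\<^sub>R x"]
    by (cases "r \<ge> 0") auto
  with add show ?thesis by (intro linearI) auto
qed

text \<open>The chain condition gives subadditivity: of two members evaluated at different points,
  the smaller one bounds both values from below.\<close>

lemma sublinear_INF_chain:
  fixes C :: "('a::real_vector \<Rightarrow> real) set"
  assumes "C \<noteq> {}" and sub: "\<And>q. q \<in> C \<Longrightarrow> sublinear q"
    and le: "\<And>q x. q \<in> C \<Longrightarrow> q x \<le> p x"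
    and chain: "\<And>q q'. q \<in> C \<Longrightarrow> q' \<in> C \<Longrightarrow> q \<le> q' \<or> q' \<le> q"
  shows "sublinear (\<lambda>x. INF q\<in>C. q x)"
    and "q \<in> C \<Longrightarrow> (INF q\<in>C. q x) \<le> q x"
proof -
  have "- p (- x) \<le> q x" if "q \<in> C" for q x
    using sublinear_minus[OF sub[OF that], of x] le[OF that, of "- x"] by simp
  then have bdd: "bdd_below ((\<lambda>q. q x) ` C)" for x
    by (intro bdd_belowI2)
  let ?g = "\<lambda>x. INF q\<in>C. q x"
  show lower: "?g x \<le> q x" if "q \<in> C" for q x
    using bdd that by (rule cINF_lower)
  have greatest: "m \<le> ?g x" if "\<And>q. q \<in> C \<Longrightarrow> m \<le> q x" for m x
    using \<open>C \<noteq> {}\<close> that by (rule cINF_greatest)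
  show "sublinear ?g"
  proof (rule sublinearI)
    fix x y
    have "?g (x + y) \<le> q x + q' y" if qq': "q \<in> C" "q' \<in> C" for q q'
    proof -
      obtain r where "r \<in> C" "r x \<le> q x" "r y \<le> q' y"
        using chain[OF qq'] qq' by (metis le_funD order_refl)
      then show ?thesis
        using lower[of r "x + y"] sublinear_add[OF sub, of r x y] by simp
    qed
    then have "?g (x + y) - q x \<le> q' y" if "q \<in> C" "q' \<in> C" for q q'
      using that by (metis diff_le_eq add.commute)
    then have "?g (x + y) - q x \<le> ?g y" if "q \<in> C" for q
      using that by (blast intro: greatest)
    then have "?g (x + y) - ?g y \<le> q x" if "q \<in> C" for q
      using that by (simp add: diff_le_eq add.commute)
    then have "?g (x + y) - ?g y \<le> ?g x"
      by (rule greatest)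
    then show "?g (x + y) \<le> ?g x + ?g y" by simp
  next
    have "?g 0 = (INF q\<in>C. 0)"
      by (intro INF_cong sublinear_0 sub) auto
    then show "?g 0 = 0"
      using \<open>C \<noteq> {}\<close> by simp
  next
    fix r :: real and x assume r: "r > 0"
    have "inverse r * ?g (r *\<^sub>R x) \<le> ?g x"
      using lower[of _ "r *\<^sub>R x"] sublinear_scaleR[OF sub] r
      by (intro greatest) (simp add: field_simps)
    then show "?g (r *\<^sub>R x) \<le> r * ?g x"
      using r by (simp add: field_simps)
  qed
qed

lemma linear_below_sublinear:
  assumes p: "sublinear p"
  obtains g where "linear g" "\<And>x. g x \<le> p x"
proof -
  define A where "A = {q. sublinear q \<and> q \<le> p}"
  have "\<exists>m\<in>A. \<forall>q\<in>A. q \<le> m \<longrightarrow> q = m"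
  proof (rule predicate_Zorn)
    \<comment> \<open>Zorn's lemma yields maximal elements, so the order is reversed to obtain a
      minimal functional.\<close>
    show "partial_order_on A (relation_of (\<lambda>q q'. q' \<le> q) A)"
      by (rule partial_order_on_relation_ofI) auto
  next
    fix C assume C: "C \<in> Chains (relation_of (\<lambda>q q'. q' \<le> q) A)"
    then have CA: "C \<subseteq> A" by (rule Chains_relation_of)
    show "\<exists>u\<in>A. \<forall>q\<in>C. u \<le> q"
    proof (cases "C = {}")
      case True
      with p show ?thesis by (auto simp: A_def)
    next
      case False
      let ?g = "\<lambda>x. INF q\<in>C. q x"
      have sub: "\<And>q. q \<in> C \<Longrightarrow> sublinear q" and le: "\<And>q x. q \<in> C \<Longrightarrow> q x \<le> p x"
        using CA by (auto simp: A_def le_fun_def)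
      have chain: "\<And>q q'. q \<in> C \<Longrightarrow> q' \<in> C \<Longrightarrow> q \<le> q' \<or> q' \<le> q"
        using C by (auto simp: Chains_def relation_of_def)
      have g: "sublinear ?g" and lower: "\<And>q x. q \<in> C \<Longrightarrow> ?g x \<le> q x"
        using sublinear_INF_chain[of C p] False sub le chain by blast+
      from False obtain q0 where "q0 \<in> C" by blast
      have "?g \<le> p"
        using lower[OF \<open>q0 \<in> C\<close>] le[OF \<open>q0 \<in> C\<close>] by (auto simp: le_fun_def intro: order_trans)
      with g lower show ?thesis by (intro bexI[of _ ?g]) (auto simp: A_def le_fun_def)
    qed
  qed
  then obtain g where g: "sublinear g" "g \<le> p" and min: "\<And>q. q \<in> A \<Longrightarrow> q \<le> g \<Longrightarrow> q = g"
    by (auto simp: A_def)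
  have "linear g"
    by (rule minimal_sublinear_linear[OF g(1)], rule min) (use g(2) in \<open>auto simp: A_def\<close>)
  with g(2) that show thesis by (auto simp: le_fun_def)
qed

text \<open>Any linear functional below the tilt at \<open>x0\<close> works: the competitor
  \<open>t = 1\<close> gives \<open>g (- x0) \<le> - p x0\<close>, which linearity turns into
  \<open>p x0 \<le> g x0\<close>.\<close>

theorem Hahn_Banach_sublinear:
  assumes p: "sublinear p"
  obtains g where "linear g" "\<And>x. g x \<le> p x" "g x0 = p x0"
proof -
  obtain g where g: "linear g" "\<And>x. g x \<le> tilt p x0 x"
    using linear_below_sublinear[OF sublinear_tilt[OF p]] by blast
  have le: "g x \<le> p x" for x
    using g(2)[of x] tilt_le_self[OF p, of x0 x] by simp
  have "g (- x0) \<le> - p x0"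
    using g(2)[of "- x0"] tilt_le[OF p, of 1 x0 "- x0"] sublinear_0[OF p] by simp
  then have "g x0 = p x0"
    using le[of x0] linear_neg[OF g(1), of x0] by simp
  with g(1) le that show thesis by blast
qed

section \<open>Passage from real to real or complex scalars\<close>

text \<open>Here \<open>j\<close> is the imaginary unit in the complex case and \<open>0\<close> in
  the real case, so that both fields can be treated at once. The last property bounds the real part
  by the norm.\<close>

lemma real_or_complex_cases:
  obtains j :: "'k::real_or_complex" where
    "j = 0 \<or> j * j = - 1"
    "\<And>c. \<exists>a b. c = of_real a + of_real b * j"
    "\<And>a b. \<bar>a\<bar> \<le> norm (of_real a + of_real b * j)"
proof -
  obtain f :: "'k \<Rightarrow> complex" where add: "\<And>x y. f (x + y) = f x + f y"
    and mult: "\<And>x y. f (x * y) = f x * f y" and nrm: "\<And>x. cmod (f x) = norm x"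
    and ran: "range f = \<real> \<or> range f = UNIV"
    using real_or_complex by metis
  have f0: "f 0 = 0" using nrm[of 0] by simp
  have minus: "f (- x) = - f x" for x
    using add[of x "- x"] f0 by (simp add: eq_neg_iff_add_eq_0 add.commute)
  have diff: "f (x - y) = f x - f y" for x y
    using add[of x "- y"] minus[of y] by simp
  have inj: "x = y" if "f x = f y" for x y
    using nrm[of "x - y"] diff[of x y] that by simp
  have "f 1 \<noteq> 0" using nrm[of 1] by auto
  then have f1: "f 1 = 1" using mult[of 1 1] by simp
  \<comment> \<open>The isometry \<open>f\<close> fixes 0 and 1. The distances of
    \<open>f (of_real r)\<close> to these two points force its real part to be \<open>r\<close>, and
    then its imaginary part to vanish.\<close>
  have freal: "f (of_real r) = of_real r" for r
  proof -
    let ?z = "f (of_real r)"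
    have "cmod ?z ^ 2 = r ^ 2" by (simp add: nrm)
    then have 1: "(Re ?z)^2 + (Im ?z)^2 = r^2" by (simp add: cmod_power2)
    have "cmod (?z - 1) = norm (of_real (r - 1) :: 'k)"
      using nrm[of "of_real r - 1"] by (simp add: diff f1)
    then have "cmod (?z - 1) ^ 2 = (r - 1) ^ 2"
      by (simp only: norm_of_real power2_abs)
    then have "(Re ?z - 1)^2 + (Im ?z)^2 = (r - 1)^2" by (simp add: cmod_power2)
    with 1 have "Re ?z = r" by (simp add: power2_eq_square algebra_simps)
    with 1 show ?thesis by (simp add: complex_eq_iff)
  qed
  show thesis
  proof (cases "range f = UNIV")
    case True
    then obtain j where j: "f j = \<i>" by (metis surjD)
    show thesis
    proof (rule that[of j])
      show "j = 0 \<or> j * j = - 1"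
        by (intro disjI2 inj) (simp add: mult j minus f1)
      show "\<exists>a b. c = of_real a + of_real b * j" for c
        by (rule exI[of _ "Re (f c)"], rule exI[of _ "Im (f c)"], rule inj)
          (simp add: add mult freal j complex_eq_iff)
      show "\<bar>a\<bar> \<le> norm (of_real a + of_real b * j)" for a b
        using abs_Re_le_cmod[of "f (of_real a + of_real b * j)"]
        unfolding nrm by (simp add: add mult freal j)
    qed
  next
    case False
    with ran have ran: "range f = \<real>" by simp
    show thesis
    proof (rule that[of 0])
      show "\<exists>a b. c = of_real a + of_real b * (0 :: 'k)" for c
      proof -
        have "f c \<in> \<real>" using ran by blast
        then obtain r where "f c = of_real r" by (auto elim: Reals_cases)
        then have "c = of_real r" by (intro inj) (simp add: freal)
        then show ?thesis by auto
      qed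
    qed auto
  qed
qed

text \<open>The real theorem gives \<open>g\<close> below \<open>p\<close> with equality at
  \<open>x0\<close>. A scalar-linear \<open>\<phi>\<close> with real part \<open>g\<close> inherits
  the bound by rotation, and attains it since
  \<open>\<bar>g x\<bar> \<le> norm (\<phi> x)\<close>.\<close>

theorem (in normed_space_over) Hahn_Banach_seminorm:
  assumes add: "\<And>x y. p (x + y) \<le> p x + p y"
    and scale: "\<And>c x. p (scale c x) = norm c * p x"
    and bound: "\<And>x. p x \<le> K * norm x"
  obtains \<phi> where "\<phi> \<in> dual" "\<And>x. norm (\<phi> x) \<le> p x" "norm (\<phi> x0) = p x0"
proof -
  have "p (r *\<^sub>R x) = \<bar>r\<bar> * p x" for r x
    using scale[of "of_real r" x] by (simp add: scale_of_real)
  then have "sublinear p" using add by (simp add: sublinear_def)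
  then obtain g where g: "linear g" "\<And>x. g x \<le> p x" "g x0 = p x0"
    using Hahn_Banach_sublinear[of p x0] by blast
  obtain j :: 'k where jj: "j = 0 \<or> j * j = - 1"
    and dec: "\<And>c :: 'k. \<exists>a b. c = of_real a + of_real b * j"
    and re: "\<And>a b. \<bar>a\<bar> \<le> norm (of_real a + of_real b * j)"
    using real_or_complex_cases by metis
  \<comment> \<open>The usual complexification \<open>g x - i * g (i * x)\<close>; for
    \<open>j = 0\<close> it is \<open>g\<close> itself, embedded in the scalars.\<close>
  define \<phi> where "\<phi> x = of_real (g x) - of_real (g (scale j x)) * j" for x
  have g_le: "\<bar>g x\<bar> \<le> norm (\<phi> x)" for x
    using re[of "g x" "- g (scale j x)"] by (simp add: \<phi>_def)
  have \<phi>_add: "\<phi> (x + y) = \<phi> x + \<phi> y" for x y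
    by (simp add: \<phi>_def scale_right_distrib linear_add[OF g(1)] algebra_simps)
  have \<phi>_real: "\<phi> (r *\<^sub>R x) = of_real r * \<phi> x" for r x
  proof -
    have "scale j (r *\<^sub>R x) = r *\<^sub>R scale j x"
      by (simp add: scale_of_real[symmetric] scale_left_commute)
    then show ?thesis
      by (simp add: \<phi>_def linear_scale[OF g(1)] algebra_simps)
  qed
  have \<phi>_j: "\<phi> (scale j x) = j * \<phi> x" for x
    using jj
  proof
    assume j: "j * j = - 1"
    then have "scale j (scale j x) = - x" by simp
    then have "\<phi> (scale j x) = of_real (g (scale j x)) + of_real (g x) * j"
      by (simp add: \<phi>_def linear_neg[OF g(1)])
    also have "\<dots> = j * of_real (g x) - of_real (g (scale j x)) * (j * j)"
      by (simp add: j mult.commute)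
    finally show ?thesis by (simp add: \<phi>_def algebra_simps)
  qed (simp add: \<phi>_def linear_0[OF g(1)])
  have \<phi>_scale: "\<phi> (scale c x) = c * \<phi> x" for c x
  proof -
    obtain a b where c: "c = of_real a + of_real b * j" using dec by blast
    have "scale c x = a *\<^sub>R x + b *\<^sub>R scale j x"
      by (simp add: c scale_left_distrib scale_of_real flip: scale_scale)
    then show ?thesis by (simp add: \<phi>_add \<phi>_real \<phi>_j c algebra_simps)
  qed
  have le: "norm (\<phi> x) \<le> p x" for x
  proof (cases "\<phi> x = 0")
    case True
    have "0 \<le> p x"
      using g(2)[of x] g(2)[of "scale (- 1) x"] scale[of "- 1" x] by (simp add: linear_neg[OF g(1)])
    with True show ?thesis by simp
  next
    case False
    \<comment> \<open>A scalar of norm one rotates \<open>\<phi> x\<close> to the real value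
      \<open>norm (\<phi> x)\<close>, which must then equal \<open>g y\<close>.\<close>
    define c where "c = of_real (norm (\<phi> x)) / \<phi> x"
    define y where "y = scale c x"
    have norm_c: "norm c = 1" using False by (simp add: c_def norm_divide)
    have y: "\<phi> y = of_real (norm (\<phi> x))" using False by (simp add: y_def \<phi>_scale c_def)
    have eq: "of_real (norm (\<phi> x) - g y) + of_real (g (scale j y)) * j = (0 :: 'k)"
      using y by (simp add: \<phi>_def algebra_simps)
    have "norm (\<phi> x) = g y"
      using re[of "norm (\<phi> x) - g y" "g (scale j y)"] unfolding eq by simp
    also have "\<dots> \<le> p y" by (rule g(2))
    also have "\<dots> = p x" by (simp add: y_def scale norm_c)
    finally show ?thesis .
  qed
  have "bounded_linear \<phi>"
  proof (rule bounded_linear_intro[where K = K])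
    show "norm (\<phi> x) \<le> norm x * K" for x
      using le[of x] bound[of x] by (simp add: mult.commute)
  qed (simp_all add: \<phi>_add \<phi>_real scaleR_conv_of_real)
  moreover have "Vector_Spaces.linear scale (*) \<phi>"
  proof -
    interpret k: normed_space_over "(*) :: 'k \<Rightarrow> 'k \<Rightarrow> 'k" by (rule normed_space_over_self)
    show ?thesis
      by unfold_locales (simp_all add: \<phi>_add \<phi>_scale)
  qed
  ultimately have "\<phi> \<in> dual" by (simp add: dual_def)
  moreover have "norm (\<phi> x0) = p x0"
    using g_le[of x0] le[of x0] g(3) by simp
  ultimately show thesis using le that by blast
qed

subsection \<open>Absolutely convergent representations\<close>

locale subspace_family = normed_space_over scale
  for scale :: "'k::real_or_complex \<Rightarrow> 'a::banach \<Rightarrow> 'a" +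
  fixes \<Lambda> :: "'i set" and X :: "'i \<Rightarrow> 'a set"
  assumes subspace_X: "l \<in> \<Lambda> \<Longrightarrow> subspace (X l)"
    and closed_X: "l \<in> \<Lambda> \<Longrightarrow> closed (X l)"
begin

text \<open>The cost \<open>c\<close> is only an upper bound for the total norm, so that costs can
  simply be added when representations are added.\<close>

definition representable :: "'a \<Rightarrow> real \<Rightarrow> bool" where
  "representable x c \<longleftrightarrow> (\<exists>u s. (\<forall>l\<in>\<Lambda>. u l \<in> X l) \<and> ((\<lambda>l. norm (u l)) has_sum s) \<Lambda> \<and> s \<le> c \<and>
     (u has_sum x) \<Lambda>)"

lemma representableI:
  assumes "\<And>l. l \<in> \<Lambda> \<Longrightarrow> u l \<in> X l" "(u has_sum x) \<Lambda>"
    and g: "(g has_sum s) \<Lambda>" "\<And>l. l \<in> \<Lambda> \<Longrightarrow> norm (u l) \<le> g l" "s \<le> c"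
  shows "representable x c"
proof -
  have "u abs_summable_on \<Lambda>"
  proof (rule summable_on_comparison_test)
    show "g summable_on \<Lambda>" using g(1) by (rule has_sum_imp_summable)
  qed (use g(2) in simp_all)
  then obtain s' where s': "((\<lambda>l. norm (u l)) has_sum s') \<Lambda>"
    by (auto simp: summable_on_def)
  moreover have "s' \<le> s"
    using s' g(1,2) by (rule has_sum_mono)
  ultimately show ?thesis
    using assms unfolding representable_def by force
qed

lemma representable_nonneg: "representable x c \<Longrightarrow> 0 \<le> c"
  unfolding representable_def by (meson has_sum_nonneg norm_ge_zero order_trans)

lemma norm_le_representable:
  assumes "representable x c"
  shows "norm x \<le> c"
proof -
  obtain u s where u: "((\<lambda>l. norm (u l)) has_sum s) \<Lambda>" "s \<le> c" "(u has_sum x) \<Lambda>"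
    using assms unfolding representable_def by blast
  then have "norm x \<le> s"
    using norm_infsum_bound[of u \<Lambda>] by (metis has_sum_iff)
  with u(2) show ?thesis by simp
qed

lemma representable_0: "representable 0 0"
  by (rule representableI[where u = "\<lambda>_. 0" and g = "\<lambda>_. 0"]) (auto intro: subspace_0 subspace_X)

lemma representable_add:
  assumes "representable x c" "representable y d"
  shows "representable (x + y) (c + d)"
proof -
  obtain u s where u: "\<forall>l\<in>\<Lambda>. u l \<in> X l" "((\<lambda>l. norm (u l)) has_sum s) \<Lambda>" "s \<le> c" "(u has_sum x) \<Lambda>"
    using assms(1) unfolding representable_def by blast
  obtain w t where w: "\<forall>l\<in>\<Lambda>. w l \<in> X l" "((\<lambda>l. norm (w l)) has_sum t) \<Lambda>" "t \<le> d" "(w has_sum y) \<Lambda>"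
    using assms(2) unfolding representable_def by blast
  show ?thesis
  proof (rule representableI)
    show "((\<lambda>l. u l + w l) has_sum x + y) \<Lambda>"
      using u w by (intro has_sum_add)
    show "((\<lambda>l. norm (u l) + norm (w l)) has_sum s + t) \<Lambda>"
      using u w by (intro has_sum_add)
  qed (use u w in \<open>auto intro: subspace_add subspace_X norm_triangle_ineq\<close>)
qed

lemma bounded_linear_scale: "bounded_linear (scale a)"
  by (rule bounded_linear_intro[where K = "norm a"])
    (simp_all add: scale_right_distrib norm_scale scale_left_commute flip: scale_of_real)

lemma representable_scale:
  assumes "representable x c"
  shows "representable (scale a x) (norm a * c)"
proof -
  obtain u s where u: "\<forall>l\<in>\<Lambda>. u l \<in> X l" "((\<lambda>l. norm (u l)) has_sum s) \<Lambda>" "s \<le> c" "(u has_sum x) \<Lambda>"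
    using assms unfolding representable_def by blast
  show ?thesis
  proof (rule representableI)
    show "((\<lambda>l. scale a (u l)) has_sum scale a x) \<Lambda>"
      using u(4) by (rule has_sum_bounded_linear[OF bounded_linear_scale])
    show "((\<lambda>l. norm a * norm (u l)) has_sum norm a * s) \<Lambda>"
      using u(2) by (rule has_sum_cmult_right)
  qed (use u in \<open>auto intro: subspace_scale subspace_X mult_left_mono simp: norm_scale\<close>)
qed

lemma representable_member:
  assumes "l \<in> \<Lambda>" "x \<in> X l"
  shows "representable x (norm x)"
proof (rule representableI)
  let ?u = "\<lambda>l'. if l' = l then x else 0"
  show "(?u has_sum x) \<Lambda>"
    using has_sum_finiteI[of "{l}" x ?u] assms(1)
    by (subst has_sum_cong_neutral[where T = "{l}" and g = ?u]) auto
  show "((\<lambda>l'. if l' = l then norm x else 0) has_sum norm x) \<Lambda>"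
    using has_sum_finiteI[of "{l}" "norm x" "\<lambda>l'. if l' = l then norm x else 0"] assms(1)
    by (subst has_sum_cong_neutral[where T = "{l}" and g = "\<lambda>l'. if l' = l then norm x else 0"]) auto
qed (use assms in \<open>auto intro: subspace_0 subspace_X\<close>)

lemma representable_span:
  assumes "x \<in> span (\<Union>l\<in>\<Lambda>. X l)"
  shows "\<exists>c. representable x c"
  using assms
  by (induction rule: span_induct_alt)
    (blast intro: representable_0 representable_add representable_scale representable_member)+

text \<open>The double family \<open>u n l\<close> is absolutely summable, so it may be summed over
  \<open>n\<close> first. Completeness provides the sums \<open>w l\<close>, and closedness keeps
  them in \<open>X l\<close>.\<close>

lemma representable_sums:
  assumes rep: "\<And>n. representable (v n) (c n)" and c: "summable c" and v: "v sums x"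
  obtains d where "representable x d"
proof -
  obtain u s where mem: "\<And>n l. l \<in> \<Lambda> \<Longrightarrow> u n l \<in> X l"
    and s: "\<And>n. ((\<lambda>l. norm (u n l)) has_sum s n) \<Lambda>" "\<And>n. s n \<le> c n"
    and u: "\<And>n. (u n has_sum v n) \<Lambda>"
    using rep unfolding representable_def by metis
  have s_nonneg: "0 \<le> s n" for n
    using s(1) by (rule has_sum_nonneg) simp
  have "summable s"
    by (rule summable_comparison_test[OF _ c]) (use s_nonneg s(2) in auto)
  then have s_sum: "s summable_on UNIV"
    using s_nonneg by (rule summable_nonneg_imp_summable_on)
  have abs_nl: "(\<lambda>(n, l). u n l) abs_summable_on UNIV \<times> \<Lambda>"
    by (rule summable_on_SigmaI[where g = s]) (use s s_sum in auto)
  then have abs_ln: "(\<lambda>(l, n). u n l) abs_summable_on \<Lambda> \<times> UNIV"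
    using summable_on_swap[of "\<lambda>(n, l). norm (u n l)" UNIV \<Lambda>] by (simp add: case_prod_unfold)
  have abs_n: "(\<lambda>n. u n l) abs_summable_on UNIV" if "l \<in> \<Lambda>" for l
    using iffD1[OF Infinite_Sum.abs_summable_on_Sigma_iff abs_ln] that by simp
  obtain z where z: "((\<lambda>(n, l). u n l) has_sum z) (UNIV \<times> \<Lambda>)"
    using abs_summable_summable[OF abs_nl] by (auto simp: summable_on_def)
  \<comment> \<open>Summing over \<open>l\<close> first identifies the total \<open>z\<close> of the
    double family with the given limit \<open>x\<close>.\<close>
  then have "(v has_sum z) UNIV"
    by (rule has_sum_SigmaD) (simp add: u)
  then have "v sums z" by (rule has_sum_imp_sums)
  with v have "z = x" by (simp add: sums_iff)
  with z have x: "((\<lambda>(l, n). u n l) has_sum x) (\<Lambda> \<times> UNIV)"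
    using has_sum_swap[of "\<lambda>(n, l). u n l" UNIV \<Lambda> x] by (simp add: case_prod_unfold)
  define w where "w l = (\<Sum>\<^sub>\<infinity>n. u n l)" for l
  define g where "g l = (\<Sum>\<^sub>\<infinity>n. norm (u n l))" for l
  have w: "((\<lambda>n. u n l) has_sum w l) UNIV" if "l \<in> \<Lambda>" for l
    using abs_summable_summable[OF abs_n[OF that]] unfolding w_def by simp
  have "(w has_sum x) \<Lambda>"
    using x by (rule has_sum_SigmaD) (simp add: w)
  moreover have "w l \<in> X l" if l: "l \<in> \<Lambda>" for l
  proof -
    have "(\<lambda>n. \<Sum>i<n. u i l) \<longlonglongrightarrow> w l"
      using has_sum_imp_sums[OF w[OF l]] by (simp add: sums_def)
    moreover have "(\<Sum>i<n. u i l) \<in> X l" for n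
      using mem[OF l] by (intro subspace_sum subspace_X[OF l]) auto
    ultimately show ?thesis
      using closed_X[OF l] by (meson closed_sequentially)
  qed
  moreover have "norm (w l) \<le> g l" if "l \<in> \<Lambda>" for l
    unfolding w_def g_def using abs_n[OF that] by (rule norm_infsum_bound)
  moreover have "(g has_sum (\<Sum>\<^sub>\<infinity>l\<in>\<Lambda>. g l)) \<Lambda>"
    using abs_ln unfolding g_def Infinite_Sum.abs_summable_on_Sigma_iff
    by (intro has_sum_infsum) (simp add: infsum_nonneg)
  ultimately show thesis
    by (intro that representableI) auto
qed

subsection \<open>Approximation modulo a subspace\<close>

text \<open>The seminorm \<open>p\<close> of the introduction: an infimal convolution of the
  representation cost, \<open>K * norm\<close> and the indicator of \<open>Y\<close>. The middle
  term keeps it finite at vectors that are not representable.\<close>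

definition cost :: "real \<Rightarrow> 'a set \<Rightarrow> 'a \<Rightarrow> real" where
  "cost K Y x = Inf {c + K * norm (x - v - y) |v c y. representable v c \<and> y \<in> Y}"

lemma cost_le:
  assumes "0 \<le> K" "representable v c" "y \<in> Y"
  shows "cost K Y x \<le> c + K * norm (x - v - y)"
  unfolding cost_def
proof (rule cInf_lower)
  show "bdd_below {c + K * norm (x - v - y) |v c y. representable v c \<and> y \<in> Y}"
    using assms(1) by (intro bdd_belowI[of _ 0]) (auto dest: representable_nonneg)
  show "c + K * norm (x - v - y) \<in> {c + K * norm (x - v - y) |v c y. representable v c \<and> y \<in> Y}"
    using assms(2,3) by (intro CollectI exI conjI) (rule refl)
qed

lemma le_cost:
  assumes "subspace Y"
    and "\<And>v c y. representable v c \<Longrightarrow> y \<in> Y \<Longrightarrow> m \<le> c + K * norm (x - v - y)"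
  shows "m \<le> cost K Y x"
  unfolding cost_def
  by (rule cInf_greatest) (use assms representable_0 subspace_0[of Y] in auto)

lemma cost_0:
  assumes "0 \<le> K" "subspace Y"
  shows "cost K Y 0 = 0"
proof (rule antisym)
  show "cost K Y 0 \<le> 0"
    using cost_le[OF assms(1) representable_0 subspace_0[OF assms(2)], of 0] by simp
  show "0 \<le> cost K Y 0"
    using assms by (intro le_cost) (auto dest: representable_nonneg)
qed

text \<open>Competitors for the two summands add up to one for the sum; the two infima are then
  taken one after the other.\<close>

lemma cost_add:
  assumes K: "0 \<le> K" and Y: "subspace Y"
  shows "cost K Y (x + x') \<le> cost K Y x + cost K Y x'"
proof -
  have *: "cost K Y (x + x') \<le> (c + K * norm (x - v - y)) + (c' + K * norm (x' - v' - y'))"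
    if "representable v c" "y \<in> Y" "representable v' c'" "y' \<in> Y" for v c y v' c' y'
  proof -
    have "cost K Y (x + x') \<le> (c + c') + K * norm ((x + x') - (v + v') - (y + y'))"
      using that by (intro cost_le K representable_add subspace_add[OF Y])
    also have "norm ((x + x') - (v + v') - (y + y')) \<le> norm (x - v - y) + norm (x' - v' - y')"
      using norm_triangle_ineq[of "x - v - y" "x' - v' - y'"] by (simp add: algebra_simps)
    finally show ?thesis
      using K by (simp add: mult_left_mono distrib_left add_ac)
  qed
  have "cost K Y (x + x') - cost K Y x \<le> c' + K * norm (x' - v' - y')"
    if "representable v' c'" "y' \<in> Y" for v' c' y'
  proof -
    have "cost K Y (x + x') - (c' + K * norm (x' - v' - y')) \<le> cost K Y x"
      using *[OF _ _ that] by (intro le_cost[OF Y]) (simp add: diff_le_eq)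
    then show ?thesis by simp
  qed
  then have "cost K Y (x + x') - cost K Y x \<le> cost K Y x'"
    by (rule le_cost[OF Y])
  then show ?thesis by simp
qed

lemma cost_scale:
  assumes K: "0 \<le> K" and Y: "subspace Y"
  shows "cost K Y (scale a x) = norm a * cost K Y x"
proof (cases "a = 0")
  case False
  have le: "cost K Y (scale b x) \<le> norm b * cost K Y x" if "b \<noteq> 0" for b x
  proof -
    have "cost K Y (scale b x) / norm b \<le> c + K * norm (x - v - y)"
      if "representable v c" "y \<in> Y" for v c y
    proof -
      have "cost K Y (scale b x) \<le> norm b * c + K * norm (scale b x - scale b v - scale b y)"
        using that by (intro cost_le K representable_scale subspace_scale[OF Y])
      also have "norm (scale b x - scale b v - scale b y) = norm b * norm (x - v - y)"
        by (simp add: norm_scale flip: scale_right_diff_distrib)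
      finally show ?thesis
        using \<open>b \<noteq> 0\<close> by (simp add: field_simps)
    qed
    then have "cost K Y (scale b x) / norm b \<le> cost K Y x"
      by (rule le_cost[OF Y])
    then show ?thesis using \<open>b \<noteq> 0\<close> by (simp add: field_simps)
  qed
  have "cost K Y x \<le> norm (inverse a) * cost K Y (scale a x)"
    using le[of "inverse a" "scale a x"] False by simp
  then have "norm a * cost K Y x \<le> cost K Y (scale a x)"
    using False unfolding norm_inverse by (simp add: field_simps)
  with le[OF False] show ?thesis by (rule antisym)
qed (simp add: cost_0 assms)

text \<open>
  The constant \<open>C\<close> may depend on the relative error \<open>\<eta>\<close>: discarding a generator of \<open>Y\<close> keeps the error
  small at the expense of \<open>C\<close>.
\<close>

definition approximable_mod :: "'a set \<Rightarrow> bool" where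
  "approximable_mod Y \<longleftrightarrow> (\<forall>\<eta>>0. \<exists>C. \<forall>x. \<exists>v c y. representable v c \<and> y \<in> Y \<and>
     c \<le> C * norm x \<and> norm (x - v - y) \<le> \<eta> * norm x)"

lemma approximable_mod_if_bounded_below:
  assumes "\<Lambda> \<noteq> {}" and Y: "subspace Y" and \<epsilon>: "\<epsilon> > 0"
    and below: "\<And>\<phi>. \<phi> \<in> annihilator Y \<Longrightarrow> \<epsilon> * onorm \<phi> \<le> (SUP l\<in>\<Lambda>. onorm_on (X l) \<phi>)"
  shows "approximable_mod Y"
proof -
  have cost_bound: "cost K Y x \<le> norm x / \<epsilon>" if K: "0 \<le> K" for K x
  proof -
    have "cost K Y z \<le> K * norm z" for z
      using cost_le[OF K representable_0 subspace_0[OF Y]] by simp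
    then obtain \<phi> where \<phi>: "\<phi> \<in> dual" "\<And>z. norm (\<phi> z) \<le> cost K Y z" "norm (\<phi> x) = cost K Y x"
      using Hahn_Banach_seminorm[of "cost K Y" K x] cost_add[OF K Y] cost_scale[OF K Y] by blast
    \<comment> \<open>The competitor \<open>v = 0\<close> together with \<open>y\<close> itself
      shows that the cost vanishes on \<open>Y\<close>.\<close>
    have "\<phi> y = 0" if "y \<in> Y" for y
      using order_trans[OF \<phi>(2)[of y] cost_le[OF K representable_0 that]] by simp
    with \<phi>(1) have "\<phi> \<in> annihilator Y" by (simp add: annihilator_def)
    then have "\<epsilon> * onorm \<phi> \<le> (SUP l\<in>\<Lambda>. onorm_on (X l) \<phi>)" by (rule below)
    also have "\<dots> \<le> 1"
    proof (rule cSUP_least[OF \<open>\<Lambda> \<noteq> {}\<close>])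
      fix l assume l: "l \<in> \<Lambda>"
      \<comment> \<open>A vector of \<open>X l\<close> represents itself at the cost of its
        norm.\<close>
      have "norm (\<phi> z) \<le> norm z" if "z \<in> X l" for z
        using \<phi>(2)[of z] cost_le[OF K representable_member[OF l that] subspace_0[OF Y], of z] by simp
      then have "norm (\<phi> z) / norm z \<le> 1" if "z \<in> X l" for z
        using that by (simp add: divide_le_eq_1)
      then show "onorm_on (X l) \<phi> \<le> 1"
        unfolding onorm_on_def using subspace_0[OF subspace_X[OF l]] by (intro cSUP_least) auto
    qed
    finally have "onorm \<phi> \<le> 1 / \<epsilon>" using \<epsilon> by (simp add: field_simps)
    moreover have "bounded_linear \<phi>" using \<phi>(1) by (simp add: dual_def)
    ultimately have "norm (\<phi> x) \<le> 1 / \<epsilon> * norm x"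
      by (meson onorm mult_right_mono norm_ge_zero order_trans)
    with \<phi>(3) show ?thesis by simp
  qed
  have "\<exists>v c y. representable v c \<and> y \<in> Y \<and> c \<le> 2 / \<epsilon> * norm x \<and> norm (x - v - y) \<le> \<eta> * norm x"
    if \<eta>: "\<eta> > 0" for \<eta> x
  proof (cases "x = 0")
    case True
    then show ?thesis using representable_0 subspace_0[OF Y] by force
  next
    case False
    \<comment> \<open>Chosen so that \<open>K * (\<eta> * norm x)\<close> equals the whole budget
      \<open>2 / \<epsilon> * norm x\<close>; the error then stays below
      \<open>\<eta> * norm x\<close>.\<close>
    define K where "K = 2 / (\<epsilon> * \<eta>)"
    have K: "K > 0" using \<epsilon> \<eta> by (simp add: K_def)
    \<comment> \<open>The factor 2 opens a strict gap above the bound on the cost, so some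
      competitor of the infimum fits into the budget.\<close>
    have "norm x / \<epsilon> < 2 / \<epsilon> * norm x" using False \<epsilon> by (simp add: field_simps)
    then have "\<not> 2 / \<epsilon> * norm x \<le> cost K Y x"
      using cost_bound[of K x] K by simp
    then obtain v c y where v: "representable v c" "y \<in> Y" "c + K * norm (x - v - y) < 2 / \<epsilon> * norm x"
      using le_cost[OF Y, of "2 / \<epsilon> * norm x" K x] by (meson not_le)
    have "c \<le> 2 / \<epsilon> * norm x"
      using v(3) K by (smt (verit) mult_nonneg_nonneg norm_ge_zero)
    moreover have "K * norm (x - v - y) \<le> K * (\<eta> * norm x)"
      using v(3) representable_nonneg[OF v(1)] \<epsilon> \<eta> by (simp add: K_def)
    ultimately show ?thesis using v K by auto
  qed
  then show ?thesis unfolding approximable_mod_def by blast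
qed

subsection \<open>Discarding the subspace\<close>

text \<open>Half of \<open>\<eta>\<close> pays for the given approximation, half for replacing
  \<open>b\<close> by \<open>w\<close>. If \<open>w\<close> lies in \<open>span S\<close>, it may
  depend on \<open>x\<close>; if it is merely representable, it is fixed before \<open>x\<close> to
  keep the cost uniform, which requires a bound on the coefficient of \<open>b\<close>.\<close>

lemma approximable_mod_span_remove:
  assumes approx: "approximable_mod (span (insert b S))"
    and b: "b \<in> closure {w. \<exists>c. representable w c}"
  shows "approximable_mod (span S)"
  unfolding approximable_mod_def
proof (intro allI impI)
  fix \<eta> :: real assume \<eta>: "\<eta> > 0"
  then obtain C where C: "\<And>x. \<exists>v c y. representable v c \<and> y \<in> span (insert b S) \<and>
     c \<le> C * norm x \<and> norm (x - v - y) \<le> \<eta> / 2 * norm x"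
    using approx unfolding approximable_mod_def by (metis half_gt_zero)
  have C': "\<exists>v c a z. representable v c \<and> z \<in> span S \<and> c \<le> C * norm x \<and>
     norm (x - v - (z + scale a b)) \<le> \<eta> / 2 * norm x" for x
  proof -
    obtain v c y where v: "representable v c" "y \<in> span (insert b S)" "c \<le> C * norm x"
      "norm (x - v - y) \<le> \<eta> / 2 * norm x"
      using C by blast
    then obtain a where "y - scale a b \<in> span S" by (auto simp: span_breakdown_eq)
    with v show ?thesis
      by (intro exI[of _ v] exI[of _ c] exI[of _ a] exI[of _ "y - scale a b"]) simp
  qed
  \<comment> \<open>The splitting into \<open>v'\<close> and \<open>z'\<close> is left open:
    \<open>scale a w\<close> joins the part in \<open>span S\<close> in the first case below and the
    representable part in the second.\<close>
  have replace: "norm (x - v' - z') \<le> \<eta> * norm x"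
    if "norm (x - v - (z + scale a b)) \<le> \<eta> / 2 * norm x" "norm a * norm (b - w) \<le> \<eta> / 2 * norm x"
      "v' + z' = v + z + scale a w" for x v z a w v' z'
  proof -
    have "x - v' - z' = (x - v - (z + scale a b)) + scale a (b - w)"
      using that(3) by (simp add: scale_right_diff_distrib algebra_simps)
    then have "norm (x - v' - z') \<le> norm (x - v - (z + scale a b)) + norm a * norm (b - w)"
      by (metis norm_triangle_ineq norm_scale)
    with that show ?thesis by simp
  qed
  show "\<exists>C. \<forall>x. \<exists>v c y. representable v c \<and> y \<in> span S \<and> c \<le> C * norm x \<and>
     norm (x - v - y) \<le> \<eta> * norm x"
  proof (cases "b \<in> closure (span S)")
    case True
    have "\<exists>v c y. representable v c \<and> y \<in> span S \<and> c \<le> C * norm x \<and> norm (x - v - y) \<le> \<eta> * norm x" for x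
    proof (cases "x = 0")
      case True
      then show ?thesis using representable_0 span_zero by force
    next
      case False
      obtain v c a z where v: "representable v c" "z \<in> span S" "c \<le> C * norm x"
        "norm (x - v - (z + scale a b)) \<le> \<eta> / 2 * norm x"
        using C' by blast
      \<comment> \<open>Adding 1 avoids dividing by zero when the coefficient vanishes.\<close>
      have a: "norm a + 1 > 0" by (simp add: add_nonneg_pos)
      then have "\<eta> / 2 * norm x / (norm a + 1) > 0"
        using \<eta> False by simp
      then obtain w where w: "w \<in> span S" "norm (b - w) < \<eta> / 2 * norm x / (norm a + 1)"
        using True by (metis closure_approachable dist_norm norm_minus_commute)
      have "norm a * norm (b - w) \<le> (norm a + 1) * norm (b - w)"
        by (intro mult_right_mono) auto
      also have "\<dots> \<le> \<eta> / 2 * norm x"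
        using less_imp_le[OF w(2)] unfolding pos_le_divide_eq[OF a] by (simp add: mult.commute)
      finally have "norm (x - v - (z + scale a w)) \<le> \<eta> * norm x"
        by (rule replace[OF v(4)]) simp
      with v w show ?thesis by (blast intro: span_add span_scale)
    qed
    then show ?thesis by blast
  next
    case False
    then obtain d where d: "d > 0" "\<And>z. z \<in> span S \<Longrightarrow> d \<le> norm (b - z)"
      by (metis closure_approachable dist_norm norm_minus_commute not_le)
    \<comment> \<open>Dividing by \<open>a\<close> turns \<open>z + scale a b\<close> into
      \<open>b\<close> minus an element of \<open>span S\<close>, at distance at least
      \<open>d\<close> from 0.\<close>
    have coeff: "norm a * d \<le> norm (z + scale a b)" if "z \<in> span S" for a z
    proof (cases "a = 0")
      case a: False
      have "norm a * d \<le> norm a * norm (b - scale (- inverse a) z)"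
        using that by (intro mult_left_mono d span_scale) auto
      also have "\<dots> = norm (scale a (b - scale (- inverse a) z))" by (simp add: norm_scale)
      also have "\<dots> = norm (z + scale a b)"
        using a by (simp add: scale_right_distrib add.commute)
      finally show ?thesis .
    qed simp
    \<comment> \<open>Bounds the coefficient relative to \<open>norm x\<close>: the numerator
      collects \<open>norm x\<close>, the cost of \<open>v\<close> and the error, and
      \<open>d\<close> comes from \<open>coeff\<close>. The sign of \<open>C\<close> is unknown,
      hence \<open>\<bar>M\<bar> + 1\<close> below.\<close>
    define M where "M = (1 + C + \<eta> / 2) / d"
    have "\<eta> / 2 / (\<bar>M\<bar> + 1) > 0" using \<eta> by simp
    then obtain w c\<^sub>w where w: "representable w c\<^sub>w" "norm (b - w) < \<eta> / 2 / (\<bar>M\<bar> + 1)"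
      using b unfolding closure_approachable dist_norm norm_minus_commute[of _ b] by blast
    have "\<exists>v c y. representable v c \<and> y \<in> span S \<and> c \<le> (C + M * c\<^sub>w) * norm x \<and>
      norm (x - v - y) \<le> \<eta> * norm x" for x
    proof -
      obtain v c a z where v: "representable v c" "z \<in> span S" "c \<le> C * norm x"
        "norm (x - v - (z + scale a b)) \<le> \<eta> / 2 * norm x"
        using C' by blast
      have "norm (z + scale a b) \<le> norm x + norm v + norm (x - v - (z + scale a b))"
        by norm
      also have "\<dots> \<le> (1 + C + \<eta> / 2) * norm x"
        using v norm_le_representable[OF v(1)] by (simp add: algebra_simps)
      finally have a: "norm a \<le> M * norm x"
        using coeff[OF v(2), of a] d(1) by (simp add: M_def field_simps)
      have "norm a * norm (b - w) \<le> ((\<bar>M\<bar> + 1) * norm x) * (\<eta> / 2 / (\<bar>M\<bar> + 1))"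
      proof (rule mult_mono)
        have "M * norm x \<le> (\<bar>M\<bar> + 1) * norm x"
          by (intro mult_right_mono) auto
        with a show "norm a \<le> (\<bar>M\<bar> + 1) * norm x" by simp
      qed (use w in auto)
      also have "\<dots> = \<eta> / 2 * norm x"
      proof -
        have "(m * n) * (e / m) = e * n" if "m \<noteq> 0" for m n e :: real
          using that by simp
        then show ?thesis by this linarith
      qed
      finally have "norm (x - (v + scale a w) - z) \<le> \<eta> * norm x"
        by (rule replace[OF v(4)]) simp
      moreover have "representable (v + scale a w) (c + norm a * c\<^sub>w)"
        by (intro representable_add representable_scale v w)
      moreover have "c + norm a * c\<^sub>w \<le> (C + M * c\<^sub>w) * norm x"
        using v(3) mult_right_mono[OF a representable_nonneg[OF w(1)]] by (simp add: algebra_simps)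
      ultimately show ?thesis using v(2) by blast
    qed
    then show ?thesis by blast
  qed
qed

text \<open>Every generator is a limit of representable vectors by density, so each can be removed
  in turn until the span of the empty set is left.\<close>

lemma approximable_mod_span_finite:
  assumes "finite B" "approximable_mod (span B)" "closure {w. \<exists>c. representable w c} = UNIV"
  shows "approximable_mod {0}"
  using assms(1,2)
  by (induction rule: finite_induct) (use assms(3) approximable_mod_span_remove in auto)

section \<open>From approximation to exact representation\<close>

text \<open>With relative error 1/2 the residuals \<open>r n\<close> decay geometrically. The
  corrections \<open>v (r n)\<close> telescope to \<open>x\<close>, and their costs are dominated by
  a geometric series.\<close>

lemma representable_if_approximable:
  assumes "approximable_mod {0}"
  obtains d where "representable x d"
proof -
  obtain C where "\<And>x. \<exists>v c. representable v c \<and> c \<le> C * norm x \<and> norm (x - v) \<le> 1 / 2 * norm x"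
    using assms unfolding approximable_mod_def
    by (metis diff_zero half_gt_zero_iff singletonD zero_less_one)
  then obtain v c where vc: "\<And>x. representable (v x) (c x)" "\<And>x. c x \<le> C * norm x"
    "\<And>x. norm (x - v x) \<le> 1 / 2 * norm x"
    by metis
  define r where "r n = ((\<lambda>x. x - v x) ^^ n) x" for n
  have r_0: "r 0 = x" and r_Suc: "r (Suc n) = r n - v (r n)" for n
    by (simp_all add: r_def)
  have norm_r: "norm (r n) \<le> (1 / 2) ^ n * norm x" for n
  proof (induction n)
    case (Suc n)
    then show ?case using vc(3)[of "r n"] by (simp add: r_Suc)
  qed (simp add: r_0)
  have "r \<longlonglongrightarrow> 0"
  proof (rule Lim_null_comparison)
    show "(\<lambda>n. (1 / 2 :: real) ^ n * norm x) \<longlonglongrightarrow> 0"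
      by (intro tendsto_mult_left_zero LIMSEQ_realpow_zero) auto
  qed (simp add: norm_r)
  then have "(\<lambda>n. v (r n)) sums x"
    using telescope_sums'[of r 0] by (simp add: r_Suc r_0)
  moreover have "summable (\<lambda>n. c (r n))"
  proof (rule summable_comparison_test')
    show "summable (\<lambda>n. \<bar>C\<bar> * ((1 / 2) ^ n * norm x))"
      by (intro summable_mult summable_mult2 summable_geometric) simp
    show "norm (c (r n)) \<le> \<bar>C\<bar> * ((1 / 2) ^ n * norm x)" for n
    proof -
      have "c (r n) \<le> C * norm (r n)" by (rule vc)
      also have "\<dots> \<le> \<bar>C\<bar> * ((1 / 2) ^ n * norm x)"
        by (intro mult_mono norm_r) auto
      finally show ?thesis using representable_nonneg[OF vc(1), of "r n"] by simp
    qed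
  qed
  ultimately show thesis
    using representable_sums[of "\<lambda>n. v (r n)" "\<lambda>n. c (r n)" x] vc(1) that by blast
qed

end

theorem theorem6p2:
  fixes scale :: "'k::real_or_complex \<Rightarrow> 'a::banach \<Rightarrow> 'a"
    and \<Lambda> :: "'i set" and X :: "'i \<Rightarrow> 'a set" and Y :: "'a set" and \<epsilon> :: real
  assumes "normed_space_over scale"
    and "\<Lambda> \<noteq> {}"
    and "\<And>l. l \<in> \<Lambda> \<Longrightarrow> module.subspace scale (X l)"
    and "\<And>l. l \<in> \<Lambda> \<Longrightarrow> closed (X l)"
    and "normed_space_over.fin_dim_subspace scale Y"
    and "closure (module.span scale (\<Union>l\<in>\<Lambda>. X l)) = UNIV"
    and "\<epsilon> > 0"
    and "\<And>\<phi>. \<phi> \<in> normed_space_over.annihilator scale Y \<Longrightarrow>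
           (SUP l\<in>\<Lambda>. onorm_on (X l) \<phi>) \<ge> \<epsilon> * onorm \<phi>"
  shows "normed_space_over.ARFS scale \<Lambda> X"
proof -
  interpret subspace_family scale \<Lambda> X
    using assms(1,3,4) by (intro subspace_family.intro subspace_family_axioms.intro)
  obtain B where B: "subspace Y" "finite B" "span B = Y"
    using assms(5) by (auto simp: fin_dim_subspace_def)
  \<comment> \<open>Finite combinations of members of the \<open>X l\<close> have some finite cost,
    so density of the span passes to the representable vectors.\<close>
  have "closure (span (\<Union>l\<in>\<Lambda>. X l)) \<subseteq> closure {w. \<exists>c. representable w c}"
    by (intro closure_mono) (auto intro: representable_span)
  then have dense: "closure {w. \<exists>c. representable w c} = UNIV"
    using assms(6) by auto
  have "approximable_mod Y"
    using assms(2,7,8) B(1) by (intro approximable_mod_if_bounded_below)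
  then have "approximable_mod {0}"
    using approximable_mod_span_finite[of B] B dense by simp
  then have "\<exists>d. representable x d" for x
    using representable_if_approximable by blast
  then show ?thesis
    unfolding ARFS_def representable_def summable_on_def
    using assms(3,4) by blast
qed

end
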